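(* Let $\Gamma$ be a finite abelian group with $\Gamma(3)=\emptyset$, and let $S\subseteq\Gamma$ be skew-symmetric with $0\notin S$. Then the oriented Cayley graph $\mathrm{Cay}(\Gamma,S)$ is HS-integral if and only if $S=\emptyset$.
   Context: $\Gamma$ is written additively. $\Gamma(3)$ is the set of elements of $\Gamma$ whose order is divisible by $3$. A set $S$ is skew-symmetric if $-a\notin S$ for all $a\in S$. $\mathrm{Cay}(\Gamma,S)$ has vertex set $\Gamma$ and arcs $(a,b)$ with $b-a\in S$. Its Hermitian adjacency matrix of second kind $\mathcal{H}=(h_{uv})$ has $h_{uv}=1$ if both $(u,v)$ and $(v,u)$ are arcs, $h_{uv}=\frac{1+i\sqrt3}{2}$ if only $(u,v)$ is an arc, $h_{uv}=\frac{1-i\sqrt3}{2}$ if only $(v,u)$ is an arc, and $h_{uv}=0$ otherwise. The graph is HS-integral if all eigenvalues of $\mathcal{H}$ are integers. *)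

theory Defs
  imports "HOL-Analysis.Analysis" "HOL-Algebra.Multiplicative_Group"
begin

definition additive_group :: "'a::ab_group_add monoid"
  where "additive_group = \<lparr>carrier = UNIV, monoid.mult = (+), one = 0\<rparr>"

lemma comm_group_additive_group: "comm_group (additive_group :: 'a::ab_group_add monoid)"
  by (rule comm_groupI) (auto simp: additive_group_def algebra_simps intro: exI[of _ "- _"])

definition add_order :: "'a::ab_group_add \<Rightarrow> nat"
  where "add_order a = group.ord additive_group a"

definition order_div_3 :: "'a::ab_group_add set"
  where "order_div_3 = {a. 3 dvd add_order a}"

definition skew_symmetric :: "'a::ab_group_add set \<Rightarrow> bool"
  where "skew_symmetric S \<longleftrightarrow> (\<forall>a\<in>S. - a \<notin> S)"

text \<open>A directed graph whose vertex set is a whole (finite) type is given by its set of arcs.\<close>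

definition Cay :: "'a::ab_group_add set \<Rightarrow> ('a \<times> 'a) set"
  where "Cay S = {(a, b). b - a \<in> S}"

definition hermitian_adj :: "('v::finite \<times> 'v) set \<Rightarrow> complex^'v^'v"
  where "hermitian_adj E = (\<chi> u v.
    if (u, v) \<in> E \<and> (v, u) \<in> E then 1
    else if (u, v) \<in> E then (1 + \<i> * complex_of_real (sqrt 3)) / 2
    else if (v, u) \<in> E then (1 - \<i> * complex_of_real (sqrt 3)) / 2
    else 0)"

definition is_eigenvalue :: "complex^'n^'n::finite \<Rightarrow> complex \<Rightarrow> bool"
  where "is_eigenvalue A c \<longleftrightarrow> (\<exists>x. x \<noteq> 0 \<and> A *v x = c *s x)"

definition HS_integral :: "('v::finite \<times> 'v) set \<Rightarrow> bool"
  where "HS_integral E \<longleftrightarrow> (\<forall>c. is_eigenvalue (hermitian_adj E) c \<longrightarrow> c \<in> \<int>)"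

end

theory Submission
  imports Defs "HOL-Number_Theory.Residues" "Jordan_Normal_Form.Char_Poly"
begin

text \<open>
  Let \<open>n\<close> be the product of the orders of all group elements, and let \<open>R\<close> be the ring generated by the
  \<open>n\<close>-th roots of unity. A function on the group with values in \<open>R\<close> becomes, after multiplication by
  some power of \<open>n\<close>, a sum of joint eigenfunctions of all translations with values in \<open>R\<close>, and these
  are eigenvectors of the Hermitian adjacency matrix. If its eigenvalues are integers, then some
  power \<open>N\<close> of \<open>n\<close> multiplies every entry into \<open>R\<close>, so that \<open>N \<surd>-3\<close> lies in \<open>R\<close> unless
  \<open>S = -S\<close>.

  But \<open>3\<close> is prime to \<open>n\<close>, hence unramified: an iterate of the Frobenius map is the identity on
  \<open>R/3R\<close>, so this ring is reduced. Since the square of \<open>N \<surd>-3\<close> is divisible by \<open>3\<close>, so is \<open>N \<surd>-3\<close>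
  itself, and \<open>-N\<^sup>2/3\<close> is an algebraic integer, although \<open>3\<close> does not divide \<open>N\<close>.
\<close>

section \<open>Integral spans\<close>

interpretation int_module: Modules.module "\<lambda>k (z :: 'a::comm_ring_1). of_int k * z"
  by unfold_locales (simp_all add: algebra_simps)

lemma int_module_subspaceI:
  assumes "0 \<in> S" and diff: "\<And>a b. a \<in> S \<Longrightarrow> b \<in> S \<Longrightarrow> a - b \<in> S"
  shows "int_module.subspace S"
proof -
  have neg: "- a \<in> S" if "a \<in> S" for a
    using diff[OF \<open>0 \<in> S\<close> that] by simp
  have add: "a + b \<in> S" if "a \<in> S" "b \<in> S" for a b
    using diff[OF that(1) neg[OF that(2)]] by simp
  have of_nat_mult: "of_nat k * a \<in> S" if "a \<in> S" for k a
    by (induction k) (use that \<open>0 \<in> S\<close> add in \<open>auto simp: distrib_right\<close>)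
  have "of_int k * a \<in> S" if "a \<in> S" for k a
    by (cases k rule: int_cases2) (use of_nat_mult[OF that] neg in auto)
  with \<open>0 \<in> S\<close> add show ?thesis
    by (rule int_module.subspaceI)
qed

lemma int_module_span_mult:
  assumes "a \<in> int_module.span B" "b \<in> int_module.span B"
    and closed: "\<And>x y. x \<in> B \<Longrightarrow> y \<in> B \<Longrightarrow> x * y \<in> int_module.span B"
  shows "a * b \<in> int_module.span B"
proof -
  have extend: "c * d \<in> int_module.span B"
    if "c \<in> int_module.span B" "\<And>x. x \<in> B \<Longrightarrow> x * d \<in> int_module.span B" for c d
  proof -
    have "int_module.subspace {x. x * d \<in> int_module.span B}"
      by (rule int_module_subspaceI)
        (auto simp: left_diff_distrib intro: int_module.span_zero int_module.span_diff)
    hence "int_module.span B \<subseteq> {x. x * d \<in> int_module.span B}"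
      using that(2) by (intro int_module.span_minimal) auto
    thus ?thesis using that(1) by blast
  qed
  have "x * b \<in> int_module.span B" if "x \<in> B" for x
    using extend[OF assms(2), of x] closed that by (simp add: mult.commute)
  with assms(1) show ?thesis by (rule extend)
qed

lemma algebraic_int_eigenvalue:
  fixes x :: "'a::field_char_0"
  assumes A: "A \<in> carrier_mat k k" and "eigenvalue (map_mat of_int A) x"
  shows "algebraic_int x"
proof -
  have "char_poly (map_mat of_int A :: 'a mat) = map_poly of_int (char_poly A)"
    using A by (rule of_int_hom.char_poly_hom)
  hence "poly (map_poly of_int (char_poly A)) x = 0"
    using assms eigenvalue_root_char_poly[of "map_mat of_int A" k x] by simp
  moreover have "lead_coeff (char_poly A) = 1"
    using degree_monic_char_poly[OF A] by simp
  ultimately show ?thesis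
    unfolding algebraic_int_altdef_ipoly by blast
qed

lemma algebraic_int_if_integer_linear_system:
  fixes x :: "'a::field_char_0" and b :: "nat \<Rightarrow> 'a"
  assumes "\<And>i. i < k \<Longrightarrow> x * b i = (\<Sum>j<k. of_int (c i j) * b j)" "i < k" "b i \<noteq> 0"
  shows "algebraic_int x"
proof (rule algebraic_int_eigenvalue)
  define A where "A = mat k k (\<lambda>(i, j). c i j)"
  show "A \<in> carrier_mat k k" by (simp add: A_def)
  have "map_mat of_int A *\<^sub>v vec k b = x \<cdot>\<^sub>v vec k b"
    by (rule eq_vecI) (simp_all add: A_def scalar_prod_def lessThan_atLeast0 assms(1))
  moreover have "vec k b \<noteq> 0\<^sub>v k"
    using assms(2,3) by (metis index_vec index_zero_vec(1))
  ultimately have "eigenvector (map_mat of_int A) (vec k b) x"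
    by (simp add: eigenvector_def A_def)
  thus "eigenvalue (map_mat of_int A) x"
    unfolding eigenvalue_def by blast
qed

lemma algebraic_int_if_span_stable:
  fixes x :: "'a::field_char_0"
  assumes "finite B" "b \<in> B" "b \<noteq> 0"
    and stable: "\<And>y. y \<in> B \<Longrightarrow> x * y \<in> int_module.span B"
  shows "algebraic_int x"
proof -
  obtain bs where bs: "set bs = B" "distinct bs"
    using finite_distinct_list[OF \<open>finite B\<close>] by blast
  have "\<exists>c :: 'a \<Rightarrow> int. x * y = (\<Sum>z\<in>B. of_int (c z) * z)" if "y \<in> B" for y
    using stable[OF that] unfolding int_module.span_finite[OF \<open>finite B\<close>] by auto
  then obtain c :: "'a \<Rightarrow> 'a \<Rightarrow> int"
    where c: "\<And>y. y \<in> B \<Longrightarrow> x * y = (\<Sum>z\<in>B. of_int (c y z) * z)"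
    by metis
  have "x * bs ! i = (\<Sum>j<length bs. of_int (c (bs ! i) (bs ! j)) * bs ! j)"
    if "i < length bs" for i
  proof -
    have "x * bs ! i = (\<Sum>z\<in>B. of_int (c (bs ! i) z) * z)"
      using that bs(1) by (intro c) auto
    also have "\<dots> = (\<Sum>j<length bs. of_int (c (bs ! i) (bs ! j)) * bs ! j)"
      by (rule sum.reindex_bij_betw[symmetric], rule bij_betw_nth) (simp_all add: bs)
    finally show ?thesis .
  qed
  moreover obtain i where "i < length bs" "bs ! i = b"
    using \<open>b \<in> B\<close> bs(1) by (auto simp: in_set_conv_nth)
  ultimately show ?thesis
    using \<open>b \<noteq> 0\<close>
    by (intro algebraic_int_if_integer_linear_system[of "length bs" x "(!) bs" _ i]) auto
qed

section \<open>The ring generated by the roots of unity\<close>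

definition cyclotomic_ring :: "nat \<Rightarrow> complex set"
  where "cyclotomic_ring n = int_module.span {z. z ^ n = 1}"

lemma root_of_unity_in_cyclotomic_ring: "z ^ n = 1 \<Longrightarrow> z \<in> cyclotomic_ring n"
  unfolding cyclotomic_ring_def by (rule int_module.span_base) simp

lemma subspace_cyclotomic_ring: "int_module.subspace (cyclotomic_ring n)"
  by (simp add: cyclotomic_ring_def)

lemmas cyclotomic_ring_0 = int_module.subspace_0[OF subspace_cyclotomic_ring]
  and cyclotomic_ring_add = int_module.subspace_add[OF subspace_cyclotomic_ring]
  and cyclotomic_ring_diff = int_module.subspace_diff[OF subspace_cyclotomic_ring]
  and cyclotomic_ring_sum = int_module.subspace_sum[OF subspace_cyclotomic_ring]

lemma cyclotomic_ring_1: "1 \<in> cyclotomic_ring n"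
  by (simp add: root_of_unity_in_cyclotomic_ring)

lemma cyclotomic_ring_of_int: "of_int k \<in> cyclotomic_ring n"
  using int_module.subspace_scale[OF subspace_cyclotomic_ring cyclotomic_ring_1] by simp

lemma cyclotomic_ring_of_nat: "of_nat k \<in> cyclotomic_ring n"
  using cyclotomic_ring_of_int[of "int k"] by simp

lemma cyclotomic_ring_mult:
  "a \<in> cyclotomic_ring n \<Longrightarrow> b \<in> cyclotomic_ring n \<Longrightarrow> a * b \<in> cyclotomic_ring n"
  unfolding cyclotomic_ring_def
  by (rule int_module_span_mult) (auto simp: power_mult_distrib intro: int_module.span_base)

lemma cyclotomic_ring_power: "a \<in> cyclotomic_ring n \<Longrightarrow> a ^ k \<in> cyclotomic_ring n"
  by (induction k) (auto intro: cyclotomic_ring_1 cyclotomic_ring_mult)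

lemma algebraic_int_cyclotomic_ring:
  assumes "n > 0" "a \<in> cyclotomic_ring n"
  shows "algebraic_int a"
proof (rule algebraic_int_if_span_stable)
  show "finite {z::complex. z ^ n = 1}"
    using \<open>n > 0\<close> by (intro finite_roots_unity) simp
  show "a * z \<in> int_module.span {z. z ^ n = 1}" if "z \<in> {z. z ^ n = 1}" for z
    using cyclotomic_ring_mult[OF assms(2) root_of_unity_in_cyclotomic_ring] that
    by (simp add: cyclotomic_ring_def)
  show "1 \<in> {z::complex. z ^ n = 1}" by simp
qed simp

definition cyclotomic_ideal :: "nat \<Rightarrow> nat \<Rightarrow> complex set"
  where "cyclotomic_ideal n m = (*) (of_nat m) ` cyclotomic_ring n"

lemma cyclotomic_idealI: "q \<in> cyclotomic_ring n \<Longrightarrow> of_nat m * q \<in> cyclotomic_ideal n m"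
  unfolding cyclotomic_ideal_def by (rule imageI)

lemma subspace_cyclotomic_ideal: "int_module.subspace (cyclotomic_ideal n m)"
  unfolding cyclotomic_ideal_def
  by (rule int_module_subspaceI)
    (auto simp flip: right_diff_distrib
      intro: image_eqI[of _ _ 0] cyclotomic_ring_0 cyclotomic_ring_diff)

lemmas cyclotomic_ideal_0 = int_module.subspace_0[OF subspace_cyclotomic_ideal]
  and cyclotomic_ideal_diff = int_module.subspace_diff[OF subspace_cyclotomic_ideal]
  and cyclotomic_ideal_sum = int_module.subspace_sum[OF subspace_cyclotomic_ideal]

lemma cyclotomic_ideal_diff_trans:
  assumes "a - b \<in> cyclotomic_ideal n m" "b - c \<in> cyclotomic_ideal n m"
  shows "a - c \<in> cyclotomic_ideal n m"
  using int_module.subspace_add[OF subspace_cyclotomic_ideal assms] by simp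

lemma cyclotomic_ideal_mult:
  assumes "a \<in> cyclotomic_ideal n m" "b \<in> cyclotomic_ring n"
  shows "a * b \<in> cyclotomic_ideal n m"
  using assms by (auto simp: cyclotomic_ideal_def mult.assoc intro: cyclotomic_ring_mult)

lemma cyclotomic_ideal_power_diff:
  assumes "a \<in> cyclotomic_ring n" "b \<in> cyclotomic_ring n" "a - b \<in> cyclotomic_ideal n m"
  shows "a ^ k - b ^ k \<in> cyclotomic_ideal n m"
proof -
  have "(\<Sum>i<k. b ^ (k - Suc i) * a ^ i) \<in> cyclotomic_ring n"
    by (intro cyclotomic_ring_sum cyclotomic_ring_mult cyclotomic_ring_power assms(1,2))
  with assms(3) show ?thesis
    unfolding power_diff_sumr2 by (rule cyclotomic_ideal_mult)
qed

section \<open>The Frobenius map modulo a prime\<close>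

lemma cyclotomic_ring_freshmans_dream:
  assumes "prime p" "a \<in> cyclotomic_ring n" "b \<in> cyclotomic_ring n"
  shows "(a + b) ^ p - (a ^ p + b ^ p) \<in> cyclotomic_ideal n p"
proof -
  have "p > 0" using \<open>prime p\<close> by (rule prime_gt_0_nat)
  hence split: "{..p} = insert 0 (insert p {0<..<p})" by auto
  have "(a + b) ^ p - (a ^ p + b ^ p) = (\<Sum>k\<in>{0<..<p}. of_nat (p choose k) * a ^ k * b ^ (p - k))"
    unfolding binomial_ring split using \<open>p > 0\<close> by simp
  also have "\<dots> \<in> cyclotomic_ideal n p"
  proof (rule cyclotomic_ideal_sum)
    fix k assume "k \<in> {0<..<p}"
    hence "p dvd p choose k" using \<open>prime p\<close> by (intro dvd_choose_prime) auto
    then obtain j where "p choose k = p * j" ..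
    hence "of_nat (p choose k) * a ^ k * b ^ (p - k) = of_nat p * (of_nat j * a ^ k * b ^ (p - k))"
      by (simp add: mult.assoc)
    also have "\<dots> \<in> cyclotomic_ideal n p"
      by (intro cyclotomic_idealI cyclotomic_ring_mult cyclotomic_ring_of_nat
          cyclotomic_ring_power assms)
    finally show "of_nat (p choose k) * a ^ k * b ^ (p - k) \<in> cyclotomic_ideal n p" .
  qed
  finally show ?thesis .
qed

lemma cyclotomic_ring_freshmans_dream_iterated:
  assumes "prime p" "a \<in> cyclotomic_ring n" "b \<in> cyclotomic_ring n"
  shows "(a + b) ^ p ^ k - (a ^ p ^ k + b ^ p ^ k) \<in> cyclotomic_ideal n p"
proof (induction k)
  case 0
  show ?case by (simp add: cyclotomic_ideal_0)
next
  case (Suc k)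
  define x y z where "x = (a + b) ^ p ^ k" and "y = a ^ p ^ k" and "z = b ^ p ^ k"
  have mem: "x \<in> cyclotomic_ring n" "y \<in> cyclotomic_ring n" "z \<in> cyclotomic_ring n"
    unfolding x_def y_def z_def by (intro cyclotomic_ring_power cyclotomic_ring_add assms)+
  have "x ^ p - (y + z) ^ p \<in> cyclotomic_ideal n p"
    by (intro cyclotomic_ideal_power_diff cyclotomic_ring_add mem)
      (use Suc.IH in \<open>simp add: x_def y_def z_def\<close>)
  moreover have "(y + z) ^ p - (y ^ p + z ^ p) \<in> cyclotomic_ideal n p"
    using \<open>prime p\<close> mem(2,3) by (rule cyclotomic_ring_freshmans_dream)
  ultimately have "x ^ p - (y ^ p + z ^ p) \<in> cyclotomic_ideal n p"
    by (rule cyclotomic_ideal_diff_trans)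
  thus ?case
    by (simp add: x_def y_def z_def mult.commute[of p] flip: power_mult)
qed

lemma cyclotomic_ring_power_cong_self:
  assumes "prime p" "[p ^ k = 1] (mod n)" "a \<in> cyclotomic_ring n"
  shows "a ^ p ^ k - a \<in> cyclotomic_ideal n p"
proof -
  define S where "S = {a \<in> cyclotomic_ring n. a ^ p ^ k - a \<in> cyclotomic_ideal n p}"
  have "int_module.subspace S"
  proof (rule int_module_subspaceI)
    show "0 \<in> S"
      using prime_gt_0_nat[OF \<open>prime p\<close>]
      by (simp add: S_def cyclotomic_ring_0 cyclotomic_ideal_0 power_0_left)
    show "a - b \<in> S" if "a \<in> S" "b \<in> S" for a b
    proof -
      have ab: "a - b \<in> cyclotomic_ring n" "b \<in> cyclotomic_ring n"
        using that by (auto simp: S_def intro: cyclotomic_ring_diff)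
      have "(a - b) ^ p ^ k - (a - b)
          = (a ^ p ^ k - a) - (b ^ p ^ k - b) - (a ^ p ^ k - ((a - b) ^ p ^ k + b ^ p ^ k))"
        by simp
      also have "\<dots> \<in> cyclotomic_ideal n p"
        using that cyclotomic_ring_freshmans_dream_iterated[OF \<open>prime p\<close> ab, of k]
        by (intro cyclotomic_ideal_diff[OF cyclotomic_ideal_diff]) (simp_all add: S_def)
      finally show ?thesis using ab(1) by (simp add: S_def)
    qed
  qed
  moreover have "{z. z ^ n = 1} \<subseteq> S"
  proof
    fix z :: complex assume "z \<in> {z. z ^ n = 1}"
    hence z: "z ^ n = 1" by simp
    have "z ^ j = z ^ (j mod n)" for j
      by (metis mult_1 mult_div_mod_eq power_add power_mult power_one z)
    hence "z ^ p ^ k = z"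
      using assms(2) unfolding cong_def by (metis power_one_right)
    thus "z \<in> S"
      using z by (simp add: S_def root_of_unity_in_cyclotomic_ring cyclotomic_ideal_0)
  qed
  ultimately have "cyclotomic_ring n \<subseteq> S"
    unfolding cyclotomic_ring_def by (intro int_module.span_minimal)
  thus ?thesis using assms(3) by (auto simp: S_def)
qed

lemma cyclotomic_ideal_radical:
  assumes "prime p" "coprime p n" "a \<in> cyclotomic_ring n" "a ^ m \<in> cyclotomic_ideal n p"
  shows "a \<in> cyclotomic_ideal n p"
proof -
  have "n > 0" using assms(1,2) by (cases "n = 0") auto
  define k where "k = totient n * m"
  have "[p ^ k = 1] (mod n)"
    using cong_pow[OF euler_theorem[OF \<open>coprime p n\<close>], of m] by (simp add: k_def power_mult)
  with \<open>prime p\<close> have "a ^ p ^ k - a \<in> cyclotomic_ideal n p"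
    using assms(3) by (rule cyclotomic_ring_power_cong_self)
  moreover have "a ^ p ^ k \<in> cyclotomic_ideal n p"
  proof -
    have "m \<le> k" using \<open>n > 0\<close> by (cases "m = 0") (simp_all add: k_def Suc_leI)
    also have "k < p ^ k" using prime_gt_1_nat[OF \<open>prime p\<close>] by (simp add: power_gt_expt)
    finally have "a ^ p ^ k = a ^ m * a ^ (p ^ k - m)"
      using power_add[of a m "p ^ k - m"] by simp
    also have "\<dots> \<in> cyclotomic_ideal n p"
      using assms(3,4) by (intro cyclotomic_ideal_mult cyclotomic_ring_power)
    finally show ?thesis .
  qed
  ultimately have "a ^ p ^ k - (a ^ p ^ k - a) \<in> cyclotomic_ideal n p"
    by (rule cyclotomic_ideal_diff[rotated])
  thus ?thesis by simp
qed

lemma prime_power_dvd_if_power_in_cyclotomic_ring: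
  assumes "prime p" "coprime p n" "a \<in> cyclotomic_ring n"
    and power: "a ^ m = of_int c" and "int p dvd c"
  shows "int p ^ m dvd c"
proof -
  have "p \<noteq> 0" using \<open>prime p\<close> by auto
  have "n > 0" using assms(1,2) by (cases "n = 0") auto
  obtain d where "c = int p * d" using \<open>int p dvd c\<close> ..
  hence "a ^ m \<in> cyclotomic_ideal n p"
    using power cyclotomic_idealI[OF cyclotomic_ring_of_int] by simp
  with assms(1-3) have "a \<in> cyclotomic_ideal n p" by (rule cyclotomic_ideal_radical)
  then obtain q where q: "q \<in> cyclotomic_ring n" "a = of_nat p * q"
    by (auto simp: cyclotomic_ideal_def)
  have "q ^ m = of_int c / of_int (int p ^ m)"
    using power \<open>p \<noteq> 0\<close> by (simp add: q(2) power_mult_distrib field_simps)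
  moreover have "algebraic_int (q ^ m)"
    using \<open>n > 0\<close> cyclotomic_ring_power[OF q(1)] by (rule algebraic_int_cyclotomic_ring)
  ultimately have "q ^ m \<in> \<int>" by (intro rational_algebraic_int_is_int) simp_all
  then obtain e where "q ^ m = of_int e" by (elim Ints_cases)
  hence "of_int c = (of_int (int p ^ m * e) :: complex)"
    using power by (simp add: q(2) power_mult_distrib)
  thus ?thesis by (simp only: of_int_eq_iff) simp
qed

lemma sqrt_minus_3_notin_cyclotomic_ring:
  assumes "coprime 3 n" "coprime 3 k"
  shows "of_nat k * (\<i> * complex_of_real (sqrt 3)) \<notin> cyclotomic_ring n"
proof
  assume mem: "of_nat k * (\<i> * complex_of_real (sqrt 3)) \<in> cyclotomic_ring n"
  have "(of_nat k * (\<i> * complex_of_real (sqrt 3)))\<^sup>2 = of_int (- 3 * (int k)\<^sup>2)"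
    by (simp add: power_mult_distrib flip: of_real_power)
  with mem assms(1) have "int 3 ^ 2 dvd - 3 * (int k)\<^sup>2"
    by (intro prime_power_dvd_if_power_in_cyclotomic_ring) auto
  hence "9 dvd 3 * (int k)\<^sup>2" by simp
  hence "3 dvd (int k)\<^sup>2" by presburger
  hence "3 dvd int k" by (rule prime_dvd_power[rotated]) simp
  hence "3 dvd k" by presburger
  with assms(2) show False by auto
qed

section \<open>Joint eigenfunctions of translations\<close>

lemma sum_power_roots_unity:
  assumes "n > 0"
  shows "(\<Sum>z | z ^ n = 1. z ^ j :: complex) = (if n dvd j then of_nat n else 0)"
proof (cases "n dvd j")
  case True
  then obtain m where "j = n * m" ..
  thus ?thesis using assms card_roots_unity_eq[of n] by (simp add: power_mult)
next
  case False
  define w where "w = exp (2 * of_real pi * \<i> * of_nat 1 / of_nat n)"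
  have "w ^ n = 1"
    using complex_root_unity[of n 1] assms by (simp add: w_def)
  have "w \<noteq> 0" by (simp add: w_def)
  have "w ^ j = exp (2 * of_real pi * \<i> * of_nat j / of_nat n)"
    unfolding w_def exp_of_nat_mult[symmetric] by (simp add: mult_ac)
  hence "w ^ j \<noteq> 1"
    using complex_root_unity_eq_1[of n j] assms False by simp
  have "(\<Sum>z | z ^ n = 1. z ^ j) = (\<Sum>z | z ^ n = 1. (w * z) ^ j)"
    by (rule sum.reindex_bij_witness[of _ "\<lambda>z. w * z" "\<lambda>z. z / w"])
      (use \<open>w ^ n = 1\<close> \<open>w \<noteq> 0\<close> in \<open>auto simp: power_mult_distrib power_divide\<close>)
  also have "\<dots> = w ^ j * (\<Sum>z | z ^ n = 1. z ^ j)"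
    by (simp add: power_mult_distrib sum_distrib_left)
  finally show ?thesis using \<open>w ^ j \<noteq> 1\<close> False by simp
qed

interpretation additive_group: comm_group "additive_group :: 'a::ab_group_add monoid"
  rewrites "carrier (additive_group :: 'a monoid) = UNIV"
    and "one (additive_group :: 'a monoid) = 0"
  by (rule comm_group_additive_group) (simp_all add: additive_group_def)

definition multiple :: "'a::ab_group_add \<Rightarrow> nat \<Rightarrow> 'a"
  where "multiple g k = g [^]\<^bsub>additive_group\<^esub> k"

lemma multiple_0 [simp]: "multiple g 0 = 0"
  by (simp add: multiple_def additive_group_def)

lemma multiple_Suc [simp]: "multiple g (Suc k) = g + multiple g k"
  by (simp add: multiple_def additive_group_def add.commute)

lemma multiple_eq_0_iff: "multiple g k = 0 \<longleftrightarrow> add_order g dvd k"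
  unfolding multiple_def add_order_def by (rule additive_group.pow_eq_id) simp

definition translation_eigenfunction :: "'a::ab_group_add set \<Rightarrow> ('a \<Rightarrow> complex) \<Rightarrow> bool"
  where "translation_eigenfunction G u \<longleftrightarrow> (\<forall>g\<in>G. \<exists>c. \<forall>x. u (g + x) = c * u x)"

definition translation_projection ::
    "nat \<Rightarrow> 'a::ab_group_add \<Rightarrow> complex \<Rightarrow> ('a \<Rightarrow> complex) \<Rightarrow> 'a \<Rightarrow> complex"
  where "translation_projection n g z u x = (\<Sum>j<n. z ^ j * u (multiple g j + x))"

lemma translation_projection_translate:
  assumes "add_order g dvd n" "z ^ n = 1"
  shows "z * translation_projection n g z u (g + x) = translation_projection n g z u x"
proof -
  define F where "F j = z ^ j * u (multiple g j + x)" for j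
  have "z * translation_projection n g z u (g + x) = (\<Sum>j<n. F (Suc j))"
    by (simp add: translation_projection_def F_def sum_distrib_left ac_simps)
  also have "\<dots> = (\<Sum>j<n. F j)"
  proof -
    have "F n = F 0"
      using assms by (simp add: F_def flip: multiple_eq_0_iff)
    thus ?thesis using sum.lessThan_Suc_shift[of F n] by simp
  qed
  finally show ?thesis by (simp add: translation_projection_def F_def)
qed

lemma sum_translation_projection:
  assumes "n > 0"
  shows "(\<Sum>z | z ^ n = 1. translation_projection n g z u x) = of_nat n * u x"
proof -
  have "(\<Sum>z | z ^ n = 1. translation_projection n g z u x)
      = (\<Sum>j<n. (\<Sum>z | z ^ n = 1. z ^ j) * u (multiple g j + x))"
    unfolding translation_projection_def sum_distrib_right by (rule sum.swap)
  also have "\<dots> = (\<Sum>j<n. if j = 0 then of_nat n * u x else 0)"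
    using assms by (intro sum.cong refl) (auto simp: sum_power_roots_unity dest: nat_dvd_not_less)
  finally show ?thesis using assms by simp
qed

lemma translation_eigenfunction_projection:
  assumes "translation_eigenfunction G u" "add_order g dvd n" "n > 0" "z ^ n = 1"
  shows "translation_eigenfunction (insert g G) (translation_projection n g z u)"
  unfolding translation_eigenfunction_def
proof (intro ballI)
  fix h assume "h \<in> insert g G"
  then consider "h = g" | "h \<in> G" by blast
  thus "\<exists>c. \<forall>x. translation_projection n g z u (h + x) = c * translation_projection n g z u x"
  proof cases
    case 1
    have "z \<noteq> 0" using \<open>z ^ n = 1\<close> \<open>n > 0\<close> by (auto simp: power_0_left)
    thus ?thesis
      using translation_projection_translate[OF assms(2,4), of u] 1
      by (intro exI[of _ "inverse z"]) (simp add: field_simps)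
  next
    case 2
    then obtain c where c: "\<And>x. u (h + x) = c * u x"
      using assms(1) by (auto simp: translation_eigenfunction_def)
    have "u (multiple g j + (h + x)) = c * u (multiple g j + x)" for j x
      using c[of "multiple g j + x"] by (simp add: ac_simps)
    thus ?thesis
      by (intro exI[of _ c]) (simp add: translation_projection_def sum_distrib_left ac_simps)
  qed
qed

lemma range_translation_projection_subset:
  assumes "range u \<subseteq> cyclotomic_ring n" "z ^ n = 1"
  shows "range (translation_projection n g z u) \<subseteq> cyclotomic_ring n"
proof -
  have "u x \<in> cyclotomic_ring n" for x
    using assms(1) by auto
  thus ?thesis
    using cyclotomic_ring_power[OF root_of_unity_in_cyclotomic_ring[OF assms(2)]]
    by (auto simp: translation_projection_def intro!: cyclotomic_ring_sum cyclotomic_ring_mult)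
qed

text \<open>
  \<open>G\<close> collects the translations that are not yet diagonalised; splitting \<open>u\<close> into its projections
  diagonalises one more of them at the cost of a factor \<open>n\<close>.
\<close>

lemma sum_mult_in_cyclotomic_ring_by_eigenfunctions:
  fixes f :: "'a::{finite, ab_group_add} \<Rightarrow> complex"
  assumes "n > 0" and exponent: "\<And>g::'a. add_order g dvd n"
    and joint: "\<And>u. range u \<subseteq> cyclotomic_ring n \<Longrightarrow> translation_eigenfunction UNIV u \<Longrightarrow>
      (\<Sum>x\<in>UNIV. f x * u x) \<in> cyclotomic_ring n"
    and "range u \<subseteq> cyclotomic_ring n" "translation_eigenfunction (- G) u"
  shows "of_nat (n ^ card G) * (\<Sum>x\<in>UNIV. f x * u x) \<in> cyclotomic_ring n"
  using finite[of G] assms(4,5)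
proof (induction G arbitrary: u rule: finite_induct)
  case empty
  thus ?case using joint by simp
next
  case (insert g G)
  let ?v = "\<lambda>z. translation_projection n g z u"
  have "of_nat (n ^ card G) * (\<Sum>x\<in>UNIV. f x * ?v z x) \<in> cyclotomic_ring n" if "z ^ n = 1" for z
  proof (rule insert.IH)
    show "range (?v z) \<subseteq> cyclotomic_ring n"
      using insert.prems(1) that by (rule range_translation_projection_subset)
    have "insert g (- insert g G) = - G" using \<open>g \<notin> G\<close> by blast
    thus "translation_eigenfunction (- G) (?v z)"
      using translation_eigenfunction_projection[OF insert.prems(2) exponent \<open>n > 0\<close> that] by metis
  qed
  hence "(\<Sum>z | z ^ n = 1. of_nat (n ^ card G) * (\<Sum>x\<in>UNIV. f x * ?v z x)) \<in> cyclotomic_ring n"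
    by (intro cyclotomic_ring_sum) simp
  also have "(\<Sum>z | z ^ n = 1. of_nat (n ^ card G) * (\<Sum>x\<in>UNIV. f x * ?v z x))
      = of_nat (n ^ card G) * (\<Sum>x\<in>UNIV. f x * (\<Sum>z | z ^ n = 1. ?v z x))"
    unfolding sum_distrib_left by (rule sum.swap)
  also have "\<dots> = of_nat (n ^ card (insert g G)) * (\<Sum>x\<in>UNIV. f x * u x)"
    using insert.hyps
    by (simp add: sum_translation_projection[OF \<open>n > 0\<close>] sum_distrib_left ac_simps)
  finally show ?case .
qed

section \<open>Circulant matrices over a finite abelian group\<close>

definition circulant ::
    "('a \<Rightarrow> complex) \<Rightarrow> complex^'a::{finite, ab_group_add}^'a::{finite, ab_group_add}"
  where "circulant w = (\<chi> a b. w (b - a))"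

lemma is_eigenvalue_circulant:
  fixes w :: "'a::{finite, ab_group_add} \<Rightarrow> complex"
  assumes "translation_eigenfunction UNIV u" "u 0 \<noteq> 0"
  shows "is_eigenvalue (circulant w) ((\<Sum>s\<in>UNIV. w s * u s) / u 0)"
proof -
  define v where "v = (\<chi> a. u a)"
  have "vec_nth v 0 \<noteq> 0" using assms(2) by (simp add: v_def)
  hence "v \<noteq> 0" by auto
  moreover have "circulant w *v v = ((\<Sum>s\<in>UNIV. w s * u s) / u 0) *s v"
    unfolding Finite_Cartesian_Product.vec_eq_iff
  proof
    fix a
    obtain c where c: "\<And>x. u (a + x) = c * u x"
      using assms(1) by (auto simp: translation_eigenfunction_def)
    have "vec_nth (circulant w *v v) a = (\<Sum>b\<in>UNIV. w (b - a) * u b)"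
      by (simp add: circulant_def v_def matrix_vector_mult_def)
    also have "\<dots> = (\<Sum>s\<in>UNIV. w s * u (a + s))"
      by (rule sum.reindex_bij_witness[of _ "\<lambda>s. a + s" "\<lambda>b. b - a"]) auto
    also have "\<dots> = (\<Sum>s\<in>UNIV. w s * u s) * c"
      by (simp add: c sum_distrib_left mult_ac)
    also have "\<dots> = (\<Sum>s\<in>UNIV. w s * u s) / u 0 * u a"
      using c[of 0] \<open>u 0 \<noteq> 0\<close> by simp
    finally show "vec_nth (circulant w *v v) a
        = vec_nth (((\<Sum>s\<in>UNIV. w s * u s) / u 0) *s v) a"
      by (simp add: v_def)
  qed
  ultimately show ?thesis unfolding is_eigenvalue_def by blast
qed

lemma circulant_entry_in_cyclotomic_ring:
  fixes w :: "'a::{finite, ab_group_add} \<Rightarrow> complex"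
  assumes "n > 0" "\<And>g::'a. add_order g dvd n"
    and eigenvalues: "\<And>c. is_eigenvalue (circulant w) c \<Longrightarrow> c \<in> cyclotomic_ring n"
  shows "of_nat (n ^ CARD('a)) * w s \<in> cyclotomic_ring n"
proof -
  have joint: "(\<Sum>x\<in>UNIV. w x * u x) \<in> cyclotomic_ring n"
    if u: "range u \<subseteq> cyclotomic_ring n" "translation_eigenfunction UNIV u" for u
  proof (cases "u 0 = 0")
    case True
    have "u x = 0" for x
    proof -
      obtain c where "\<And>y. u (x + y) = c * u y"
        using u(2) by (auto simp: translation_eigenfunction_def)
      from this[of 0] True show ?thesis by simp
    qed
    thus ?thesis by (simp add: cyclotomic_ring_0)
  next
    case False
    have "u 0 \<in> cyclotomic_ring n" using u(1) by auto
    with eigenvalues[OF is_eigenvalue_circulant[OF u(2) False]]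
    have "(\<Sum>x\<in>UNIV. w x * u x) / u 0 * u 0 \<in> cyclotomic_ring n"
      by (rule cyclotomic_ring_mult)
    thus ?thesis using False by simp
  qed
  have "of_nat (n ^ CARD('a)) * (\<Sum>x\<in>UNIV. w x * of_bool (x = s)) \<in> cyclotomic_ring n"
    by (rule sum_mult_in_cyclotomic_ring_by_eigenfunctions[OF assms(1,2) joint])
      (auto simp: translation_eigenfunction_def cyclotomic_ring_0 cyclotomic_ring_1)
  thus ?thesis by (simp add: of_bool_def if_distrib cong: if_cong)
qed

definition hermitian_weight :: "'a::ab_group_add set \<Rightarrow> 'a \<Rightarrow> complex"
  where "hermitian_weight S s =
    (if s \<in> S \<and> - s \<in> S then 1
     else if s \<in> S then (1 + \<i> * complex_of_real (sqrt 3)) / 2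
     else if - s \<in> S then (1 - \<i> * complex_of_real (sqrt 3)) / 2
     else 0)"

lemma hermitian_adj_Cay: "hermitian_adj (Cay S) = circulant (hermitian_weight S)"
  by (simp add: hermitian_adj_def circulant_def hermitian_weight_def Cay_def cong: if_cong)

lemma HS_integral_empty: "HS_integral ({} :: ('v::finite \<times> 'v) set)"
proof -
  have "hermitian_adj ({} :: ('v \<times> 'v) set) = 0"
    by (simp add: hermitian_adj_def Finite_Cartesian_Product.vec_eq_iff)
  thus ?thesis
    by (auto simp: HS_integral_def is_eigenvalue_def)
qed

lemma hermitian_weight_diff_uminus:
  assumes "s \<in> S" "- s \<notin> S"
  shows "hermitian_weight S s - hermitian_weight S (- s) = \<i> * complex_of_real (sqrt 3)"
  using assms by (simp add: hermitian_weight_def field_simps)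

lemma HS_integral_imp_hermitian_weight_in_cyclotomic_ring:
  fixes S :: "'a::{finite, ab_group_add} set"
  assumes "HS_integral (Cay S)" "n > 0" "\<And>g::'a. add_order g dvd n"
  shows "of_nat (n ^ CARD('a)) * hermitian_weight S s \<in> cyclotomic_ring n"
  using assms(2,3)
proof (rule circulant_entry_in_cyclotomic_ring)
  fix c assume "is_eigenvalue (circulant (hermitian_weight S)) c"
  hence "c \<in> \<int>"
    using assms(1) by (simp add: HS_integral_def hermitian_adj_Cay)
  thus "c \<in> cyclotomic_ring n"
    by (auto elim!: Ints_cases intro: cyclotomic_ring_of_int)
qed

lemma HS_integral_Cay_imp_uminus_mem:
  fixes S :: "'a::{finite, ab_group_add} set"
  assumes "HS_integral (Cay S)" "coprime 3 n" "\<And>g::'a. add_order g dvd n" "s \<in> S"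
  shows "- s \<in> S"
proof (rule ccontr)
  assume "- s \<notin> S"
  have "n > 0" using assms(2) by (cases "n = 0") auto
  define N where "N = n ^ CARD('a)"
  have "of_nat N * hermitian_weight S s - of_nat N * hermitian_weight S (- s) \<in> cyclotomic_ring n"
    unfolding N_def
    by (intro cyclotomic_ring_diff HS_integral_imp_hermitian_weight_in_cyclotomic_ring
        assms(1,3) \<open>n > 0\<close>)
  hence "of_nat N * (\<i> * complex_of_real (sqrt 3)) \<in> cyclotomic_ring n"
    by (simp only: hermitian_weight_diff_uminus[OF \<open>s \<in> S\<close> \<open>- s \<notin> S\<close>] flip: right_diff_distrib)
  moreover have "coprime 3 N"
    unfolding N_def using assms(2) by simp
  ultimately show False
    using sqrt_minus_3_notin_cyclotomic_ring[OF assms(2)] by blast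
qed

theorem theorem3p2:
  fixes S :: "'a::{finite, ab_group_add} set"
  assumes "(order_div_3 :: 'a set) = {}"
    and "skew_symmetric S"
    and "0 \<notin> S"
  shows "HS_integral (Cay S) \<longleftrightarrow> S = {}"
proof
  assume "S = {}"
  hence "Cay S = {}" by (simp add: Cay_def)
  thus "HS_integral (Cay S)" by (simp add: HS_integral_empty)
next
  assume "HS_integral (Cay S)"
  define n where "n = (\<Prod>g\<in>(UNIV :: 'a set). add_order g)"
  have "coprime 3 (add_order g)" for g :: 'a
    using assms(1) by (intro prime_imp_coprime) (auto simp: order_div_3_def)
  hence "coprime 3 n" unfolding n_def by (intro prod_coprime_right)
  moreover have "add_order g dvd n" for g :: 'a
    unfolding n_def by (intro dvd_prodI) auto
  ultimately have "- s \<in> S" if "s \<in> S" for s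
    using HS_integral_Cay_imp_uminus_mem[OF \<open>HS_integral (Cay S)\<close>] that by blast
  thus "S = {}"
    using assms(2) by (auto simp: skew_symmetric_def)
qed

end
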